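(* Let $\mathbf{A},\mathbf{B}$ be finite $\sigma$-structures with universes $A,B$. Suppose that (1) for every $a\in A$ there exist a homomorphism $h$ from $\mathbf{A}$ to $\mathbf{B}$ and a homomorphism $g$ from $\mathbf{B}$ to $\mathbf{A}$ with $g(h(a))=a$; and (2) for every $b\in B$ there exist a homomorphism $h$ from $\mathbf{A}$ to $\mathbf{B}$ and a homomorphism $g$ from $\mathbf{B}$ to $\mathbf{A}$ with $h(g(b))=b$. Then for every finite set $\mathcal{V}$ of views over $\sigma$, $\Lambda^{\mathcal{V}}(\mathbf{A})$ and $\Lambda^{\mathcal{V}}(\mathbf{B})$ satisfy the same first-order sentences without equality over the unary vocabulary $\mathcal{V}$ of quantifier rank $1$.
   Context: A view over $\sigma$ is a unary conjunctive query without equality and without negation: $V(y)\equiv\exists x_1,\ldots,x_n\,(R_1(u_1)\wedge\cdots\wedge R_k(u_k))$ with exactly one free variable $y$, $R_i\in\sigma$, $u_i$ tuples of variables. For a $\sigma$-structure $\mathbf{I}$ with universe $I$ and a finite set $\mathcal{V}$ of views, $\Lambda^{\mathcal{V}}(\mathbf{I})$ is the structure over the unary vocabulary $\mathcal{V}$ with universe $I$ in which each $V\in\mathcal{V}$ is interpreted as the set of elements of $\mathbf{I}$ satisfying the view $V$. A homomorphism from $\mathbf{A}$ to $\mathbf{B}$ is a map $h:A\to B$ such that $(h(a_1),\ldots,h(a_r))\in R^{\mathbf{B}}$ whenever $(a_1,\ldots,a_r)\in R^{\mathbf{A}}$, for every $R\in\sigma$. *)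

theory Defs
  imports Main "HOL-Library.FuncSet"
begin

record 's vocabulary =
  symbols :: "'s set"
  arity :: "'s \<Rightarrow> nat"

record ('s, 'a) struct =
  universe :: "'a set"
  interp :: "'s \<Rightarrow> 'a list set"

(* The empty universe is allowed, so that statements about all structures also cover
   the convention in which universes are nonempty. *)
definition is_struct :: "'s vocabulary \<Rightarrow> ('s, 'a) struct \<Rightarrow> bool" where
  "is_struct \<sigma> S \<longleftrightarrow>
     (\<forall>R\<in>symbols \<sigma>. interp S R \<subseteq> {as. set as \<subseteq> universe S \<and> length as = arity \<sigma> R})"

definition is_hom ::
    "'s vocabulary \<Rightarrow> ('s, 'a) struct \<Rightarrow> ('s, 'b) struct \<Rightarrow> ('a \<Rightarrow> 'b) \<Rightarrow> bool" where
  "is_hom \<sigma> A B h \<longleftrightarrow> h \<in> universe A \<rightarrow> universe B \<and>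
     (\<forall>R\<in>symbols \<sigma>. \<forall>as\<in>interp A R. map h as \<in> interp B R)"

type_synonym var = nat

(* First-order formulas without equality over relation symbols of type 's. *)
datatype 's form =
    Falsum
  | Atom 's "var list"
  | Neg "'s form"
  | Conj "'s form" "'s form"
  | Disj "'s form" "'s form"
  | Ex var "'s form"
  | All var "'s form"

fun fvars :: "'s form \<Rightarrow> var set" where
  "fvars Falsum = {}"
| "fvars (Atom R us) = set us"
| "fvars (Neg \<phi>) = fvars \<phi>"
| "fvars (Conj \<phi> \<psi>) = fvars \<phi> \<union> fvars \<psi>"
| "fvars (Disj \<phi> \<psi>) = fvars \<phi> \<union> fvars \<psi>"
| "fvars (Ex x \<phi>) = fvars \<phi> - {x}"
| "fvars (All x \<phi>) = fvars \<phi> - {x}"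

fun qrank :: "'s form \<Rightarrow> nat" where
  "qrank Falsum = 0"
| "qrank (Atom R us) = 0"
| "qrank (Neg \<phi>) = qrank \<phi>"
| "qrank (Conj \<phi> \<psi>) = max (qrank \<phi>) (qrank \<psi>)"
| "qrank (Disj \<phi> \<psi>) = max (qrank \<phi>) (qrank \<psi>)"
| "qrank (Ex x \<phi>) = Suc (qrank \<phi>)"
| "qrank (All x \<phi>) = Suc (qrank \<phi>)"

fun is_form :: "'s vocabulary \<Rightarrow> 's form \<Rightarrow> bool" where
  "is_form \<sigma> Falsum \<longleftrightarrow> True"
| "is_form \<sigma> (Atom R us) \<longleftrightarrow> R \<in> symbols \<sigma> \<and> length us = arity \<sigma> R"
| "is_form \<sigma> (Neg \<phi>) \<longleftrightarrow> is_form \<sigma> \<phi>"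
| "is_form \<sigma> (Conj \<phi> \<psi>) \<longleftrightarrow> is_form \<sigma> \<phi> \<and> is_form \<sigma> \<psi>"
| "is_form \<sigma> (Disj \<phi> \<psi>) \<longleftrightarrow> is_form \<sigma> \<phi> \<and> is_form \<sigma> \<psi>"
| "is_form \<sigma> (Ex x \<phi>) \<longleftrightarrow> is_form \<sigma> \<phi>"
| "is_form \<sigma> (All x \<phi>) \<longleftrightarrow> is_form \<sigma> \<phi>"

definition is_sentence :: "'s vocabulary \<Rightarrow> 's form \<Rightarrow> bool" where
  "is_sentence \<sigma> \<phi> \<longleftrightarrow> is_form \<sigma> \<phi> \<and> fvars \<phi> = {}"

fun sat :: "('s, 'a) struct \<Rightarrow> (var \<Rightarrow> 'a) \<Rightarrow> 's form \<Rightarrow> bool" where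
  "sat S v Falsum \<longleftrightarrow> False"
| "sat S v (Atom R us) \<longleftrightarrow> map v us \<in> interp S R"
| "sat S v (Neg \<phi>) \<longleftrightarrow> \<not> sat S v \<phi>"
| "sat S v (Conj \<phi> \<psi>) \<longleftrightarrow> sat S v \<phi> \<and> sat S v \<psi>"
| "sat S v (Disj \<phi> \<psi>) \<longleftrightarrow> sat S v \<phi> \<or> sat S v \<psi>"
| "sat S v (Ex x \<phi>) \<longleftrightarrow> (\<exists>a\<in>universe S. sat S (v(x := a)) \<phi>)"
| "sat S v (All x \<phi>) \<longleftrightarrow> (\<forall>a\<in>universe S. sat S (v(x := a)) \<phi>)"

(* For a sentence the assignment is irrelevant; v is not confined to the universe,
   which would make the quantifier vacuous when the universe is empty. *)
definition models :: "('s, 'a) struct \<Rightarrow> 's form \<Rightarrow> bool" where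
  "models S \<phi> \<longleftrightarrow> (\<forall>v. sat S v \<phi>)"

fun conjunction :: "'s form list \<Rightarrow> 's form" where
  "conjunction [] = Neg Falsum"
| "conjunction [\<phi>] = \<phi>"
| "conjunction (\<phi> # \<psi> # \<phi>s) = Conj \<phi> (conjunction (\<psi> # \<phi>s))"

(* View y [x1, ..., xn] [(R1, u1), ..., (Rk, uk)] *)
datatype 's view =
  View (head_var: var) (bound_vars: "var list") (view_atoms: "('s \<times> var list) list")

definition view_form :: "'s view \<Rightarrow> 's form" where
  "view_form V =
     foldr Ex (bound_vars V) (conjunction (map (\<lambda>(R, u). Atom R u) (view_atoms V)))"

(* The condition on the free variables forces the head variable to occur in some atom,
   hence the conjunction to be nonempty. *)
definition is_view :: "'s vocabulary \<Rightarrow> 's view \<Rightarrow> bool" where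
  "is_view \<sigma> V \<longleftrightarrow> is_form \<sigma> (view_form V) \<and> fvars (view_form V) = {head_var V}"

(* The head variable is the only free variable, so the constant assignment is as good
   as any assignment into the universe that sends the head variable to a. *)
definition satisfies_view :: "('s, 'a) struct \<Rightarrow> 'a \<Rightarrow> 's view \<Rightarrow> bool" where
  "satisfies_view S a V \<longleftrightarrow> sat S (\<lambda>_. a) (view_form V)"

definition view_vocabulary :: "'s view set \<Rightarrow> 's view vocabulary" where
  "view_vocabulary \<V> = \<lparr>symbols = \<V>, arity = (\<lambda>_. 1)\<rparr>"

(* The structure over the unary vocabulary of views; unary relations are sets of
   one-element lists. *)
definition view_struct :: "'s view set \<Rightarrow> ('s, 'a) struct \<Rightarrow> ('s view, 'a) struct" where
  "view_struct \<V> S =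
     \<lparr>universe = universe S,
      interp = (\<lambda>V. {[a] | a. V \<in> \<V> \<and> a \<in> universe S \<and> satisfies_view S a V})\<rparr>"

end

theory Submission
  imports Defs
begin

text \<open>Views are positive existential, so homomorphisms preserve them: an element \<open>a\<close> with
  \<open>g (h a) = a\<close> satisfies exactly the same views as \<open>h a\<close>. Hence the same types of elements occur
  in both view structures, and over a unary vocabulary without equality a sentence of quantifier
  rank 1 only sees which types occur.\<close>

lemma sat_conjunction: "sat S v (conjunction \<phi>s) \<longleftrightarrow> (\<forall>\<phi>\<in>set \<phi>s. sat S v \<phi>)"
  by (induction \<phi>s rule: conjunction.induct) auto

lemma is_form_conjunction: "is_form \<sigma> (conjunction \<phi>s) \<longleftrightarrow> (\<forall>\<phi>\<in>set \<phi>s. is_form \<sigma> \<phi>)"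
  by (induction \<phi>s rule: conjunction.induct) auto

lemma is_form_foldr_Ex: "is_form \<sigma> (foldr Ex xs \<phi>) \<longleftrightarrow> is_form \<sigma> \<phi>"
  by (induction xs) auto

text \<open>A witness \<open>a\<close> for a quantified variable is sent to the witness
  \<open>h a\<close>, and composing with \<open>h\<close> commutes with updating the assignment. The
  matrix is assumed preserved under every assignment because each quantifier changes
  \<open>v\<close>.\<close>

lemma sat_foldr_Ex_hom:
  assumes "is_hom \<sigma> A B h"
    and "\<And>v. sat A v \<phi> \<Longrightarrow> sat B (h \<circ> v) \<phi>"
    and "sat A v (foldr Ex xs \<phi>)"
  shows "sat B (h \<circ> v) (foldr Ex xs \<phi>)"
  using assms(3)
proof (induction xs arbitrary: v)
  case Nil
  then show ?case using assms(2) by (simp add: comp_def)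
next
  case (Cons x xs)
  then obtain a where a: "a \<in> universe A" "sat A (v(x := a)) (foldr Ex xs \<phi>)"
    by auto
  have "h a \<in> universe B" using assms(1) a(1) by (auto simp: is_hom_def)
  moreover have "sat B ((h \<circ> v)(x := h a)) (foldr Ex xs \<phi>)"
    using Cons.IH[OF a(2)] by (simp only: fun_upd_comp)
  ultimately show ?case by (auto simp: comp_def)
qed

text \<open>Homomorphisms preserve atoms, hence conjunctions of atoms, hence their existential
  closures.\<close>

lemma satisfies_view_hom:
  assumes hom: "is_hom \<sigma> A B h" and "is_view \<sigma> V" and "satisfies_view A a V"
  shows "satisfies_view B (h a) V"
proof -
  let ?\<phi> = "conjunction (map (\<lambda>(R, u). Atom R u) (view_atoms V))"
  have "is_form \<sigma> ?\<phi>"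
    using assms(2) by (simp add: is_view_def view_form_def is_form_foldr_Ex)
  \<comment> \<open>\<open>is_hom\<close> constrains only symbols of \<open>\<sigma>\<close>, so the
    atoms of the view must be known to use such symbols.\<close>
  then have symb: "R \<in> symbols \<sigma>" if "(R, u) \<in> set (view_atoms V)" for R u
    using that by (fastforce simp: is_form_conjunction)
  have "sat B (h \<circ> v) ?\<phi>" if "sat A v ?\<phi>" for v
    using that hom symb by (fastforce simp: sat_conjunction is_hom_def)
  from sat_foldr_Ex_hom[OF hom this] assms(3) have "sat B (h \<circ> (\<lambda>_. a)) (view_form V)"
    by (simp add: satisfies_view_def view_form_def)
  then show ?thesis by (simp add: satisfies_view_def comp_def)
qed

lemma satisfies_view_hom_iff:
  assumes "is_hom \<sigma> A B h" and "is_hom \<sigma> B A g" and "g (h a) = a" and "is_view \<sigma> V"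
  shows "satisfies_view A a V \<longleftrightarrow> satisfies_view B (h a) V"
  using satisfies_view_hom[OF assms(1,4)] satisfies_view_hom[OF assms(2,4), of "h a"] assms(3)
  by auto

text \<open>Without equality, the only atoms in the single variable \<open>x\<close> are of the form
  \<open>R(x)\<close>, so Boolean combinations of them cannot separate elements of the same
  type.\<close>

lemma sat_quantifier_free_unary:
  assumes "\<forall>R\<in>symbols \<sigma>. arity \<sigma> R = 1"
    and "\<forall>R\<in>symbols \<sigma>. [v x] \<in> interp S R \<longleftrightarrow> [w x] \<in> interp T R"
    and "is_form \<sigma> \<phi>" and "qrank \<phi> = 0" and "fvars \<phi> \<subseteq> {x}"
  shows "sat S v \<phi> \<longleftrightarrow> sat T w \<phi>"
  using assms(3-)
proof (induction \<phi>)
  case (Atom R us)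
  with assms(1) have "us = [x]" by (auto simp: length_Suc_conv)
  with Atom assms(2) show ?case by simp
qed auto

text \<open>A one-round back-and-forth argument: a quantifier's witness or counterexample is
  exchanged for an element of the same type on the other side. The bound is \<open>\<le> 1\<close>
  because the Boolean parts of a rank 1 sentence may have rank 0.\<close>

lemma sat_sentence_rank_le_1_unary:
  assumes unary: "\<forall>R\<in>symbols \<sigma>. arity \<sigma> R = 1"
    and forward: "\<forall>a\<in>universe S. \<exists>b\<in>universe T.
      \<forall>R\<in>symbols \<sigma>. [a] \<in> interp S R \<longleftrightarrow> [b] \<in> interp T R"
    and backward: "\<forall>b\<in>universe T. \<exists>a\<in>universe S.
      \<forall>R\<in>symbols \<sigma>. [a] \<in> interp S R \<longleftrightarrow> [b] \<in> interp T R"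
    and "is_form \<sigma> \<phi>" and "fvars \<phi> = {}" and "qrank \<phi> \<le> 1"
  shows "sat S v \<phi> \<longleftrightarrow> sat T w \<phi>"
  using assms(4-)
proof (induction \<phi>)
  case (Atom R us)
  \<comment> \<open>A unary atom contains a variable, so it cannot be closed.\<close>
  with unary show ?case by auto
next
  case (Ex x \<phi>)
  have "sat S (v(x := a)) \<phi> \<longleftrightarrow> sat T (w(x := b)) \<phi>"
    if "\<forall>R\<in>symbols \<sigma>. [a] \<in> interp S R \<longleftrightarrow> [b] \<in> interp T R" for a b
    using sat_quantifier_free_unary[OF unary, of "v(x := a)" x S "w(x := b)" T \<phi>] that Ex.prems
    by auto
  with forward backward show ?case by (simp, blast)
next
  case (All x \<phi>)
  have "sat S (v(x := a)) \<phi> \<longleftrightarrow> sat T (w(x := b)) \<phi>"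
    if "\<forall>R\<in>symbols \<sigma>. [a] \<in> interp S R \<longleftrightarrow> [b] \<in> interp T R" for a b
    using sat_quantifier_free_unary[OF unary, of "v(x := a)" x S "w(x := b)" T \<phi>] that All.prems
    by auto
  with forward backward show ?case by (simp, blast)
qed auto

theorem theorem7p5:
  fixes \<sigma> :: "'s vocabulary"
    and A :: "('s, 'a) struct" and B :: "('s, 'b) struct"
  assumes "is_struct \<sigma> A" and "finite (universe A)"
    and "is_struct \<sigma> B" and "finite (universe B)"
    and "\<forall>a\<in>universe A. \<exists>h g. is_hom \<sigma> A B h \<and> is_hom \<sigma> B A g \<and> g (h a) = a"
    and "\<forall>b\<in>universe B. \<exists>h g. is_hom \<sigma> A B h \<and> is_hom \<sigma> B A g \<and> h (g b) = b"
  shows "\<forall>\<V>. finite \<V> \<and> (\<forall>V\<in>\<V>. is_view \<sigma> V) \<longrightarrow>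
           (\<forall>\<phi>. is_sentence (view_vocabulary \<V>) \<phi> \<and> qrank \<phi> = 1 \<longrightarrow>
              (models (view_struct \<V> A) \<phi> \<longleftrightarrow> models (view_struct \<V> B) \<phi>))"
proof (intro allI impI)
  fix \<V> :: "'s view set" and \<phi>
  assume "finite \<V> \<and> (\<forall>V\<in>\<V>. is_view \<sigma> V)"
    and \<phi>: "is_sentence (view_vocabulary \<V>) \<phi> \<and> qrank \<phi> = 1"
  then have views: "is_view \<sigma> V" if "V \<in> \<V>" for V
    using that by blast
  have forward: "\<exists>b\<in>universe B. \<forall>V\<in>\<V>. satisfies_view A a V \<longleftrightarrow> satisfies_view B b V"
    if a: "a \<in> universe A" for a
  proof -
    obtain h g where hg: "is_hom \<sigma> A B h" "is_hom \<sigma> B A g" "g (h a) = a"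
      using assms(5) a by blast
    then have "h a \<in> universe B" using a by (auto simp: is_hom_def)
    with satisfies_view_hom_iff[OF hg views] show ?thesis by blast
  qed
  have backward: "\<exists>a\<in>universe A. \<forall>V\<in>\<V>. satisfies_view A a V \<longleftrightarrow> satisfies_view B b V"
    if b: "b \<in> universe B" for b
  proof -
    \<comment> \<open>The roles are swapped: \<open>g\<close> carries \<open>b\<close> into
      \<open>A\<close> and \<open>h\<close> brings it back, so the equivalence applies with
      \<open>B\<close> as the source.\<close>
    obtain h g where hg: "is_hom \<sigma> B A g" "is_hom \<sigma> A B h" "h (g b) = b"
      using assms(6) b by blast
    then have "g b \<in> universe A" using b by (auto simp: is_hom_def)
    with satisfies_view_hom_iff[OF hg views] show ?thesis by blast
  qed
  \<comment> \<open>The assignments \<open>v\<close> and \<open>w\<close> are independent, as they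
    take values in different types; this lets the quantifiers over assignments in
    \<open>models\<close> be matched.\<close>
  have "sat (view_struct \<V> A) v \<phi> \<longleftrightarrow> sat (view_struct \<V> B) w \<phi>" for v w
  proof (rule sat_sentence_rank_le_1_unary[where \<sigma> = "view_vocabulary \<V>"])
    show "\<forall>a\<in>universe (view_struct \<V> A). \<exists>b\<in>universe (view_struct \<V> B).
        \<forall>V\<in>symbols (view_vocabulary \<V>).
          [a] \<in> interp (view_struct \<V> A) V \<longleftrightarrow> [b] \<in> interp (view_struct \<V> B) V"
      using forward by (fastforce simp: view_struct_def view_vocabulary_def)
    show "\<forall>b\<in>universe (view_struct \<V> B). \<exists>a\<in>universe (view_struct \<V> A).
        \<forall>V\<in>symbols (view_vocabulary \<V>).
          [a] \<in> interp (view_struct \<V> A) V \<longleftrightarrow> [b] \<in> interp (view_struct \<V> B) V"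
      using backward by (fastforce simp: view_struct_def view_vocabulary_def)
  qed (use \<phi> in \<open>auto simp: is_sentence_def view_vocabulary_def\<close>)
  then show "models (view_struct \<V> A) \<phi> \<longleftrightarrow> models (view_struct \<V> B) \<phi>"
    unfolding models_def by blast
qed

end
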